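(* Let $\xi=(L^\xi,\Delta_0^\xi,B^\xi,d,G)$ be a generic configuration that is EA-stable. Then the axiom system $B^\xi+\mathrm{SelfCons}^1(B^\xi,d)$ (with deduction method $d$) is self-justifying.
   Context: **Generic configurations.** Standard-M is the standard model of the natural numbers. $\mathrm{Log}$ is the base-2 logarithm. A generic configuration $\xi$ is a 5-tuple $(L^\xi,\Delta_0^\xi,B^\xi,d,G)$ where: (1) $L^\xi$ is a language with symbols for $0,1,2,=,\le$ and $\mathrm{Maximum}(x,y)$, and enough function and constant symbols that every integer $k$ is the value of some term $T_k$. (2) $\Delta_0^\xi$ is a fixed class of fully bounded $L^\xi$-formulas (all quantifiers have the form $\exists v\le T$ or $\forall v\le T$ with $T$ a term), closed under negation, and rich enough to contain two formulas $\mathrm{Add}(x,y,z)$ and $\mathrm{Mult}(x,y,z)$ defining the graphs of addition and multiplication. Every $\Delta_0^\xi$ formula is both $\Pi_0^\xi$ and $\Sigma_0^\xi$; for $n\ge1$ a formula is $\Pi_n^\xi$ (resp. $\Sigma_n^\xi$) iff it can be written $\forall v_1\cdots\forall v_k\,\Phi$ with $\Phi\in\Sigma_{n-1}^\xi$ (resp. $\exists v_1\cdots\exists v_k\,\Phi$ with $\Phi\in\Pi_{n-1}^\xi$); $\Delta_0^\xi$ sentences count as both $\Pi_1^\xi$ and $\Sigma_1^\xi$. (3) $B^\xi$ (the base axiom system) is an axiom system whose axioms are true in Standard-M and which is $\Sigma_1^\xi$-complete: it proves every true $\Sigma_1^\xi$ sentence and refutes every false $\Pi_1^\xi$ sentence.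 (4) $d$ is a deduction method, conventional enough to satisfy the indirect-implication property associated with Gödel's Completeness Theorem: whether or not modus ponens is built in, whenever it can prove $X$, $Y$ and $(X\wedge Y)\to Z$, it can prove $Z$ (possibly by a much longer proof). (5) $G$ is a method for encoding the Gödel numbers of proofs. Proofs are identified with their Gödel numbers $p$. **Goodness.** $E(N)$ is a term of value $2^N$. For a prenex sentence $\Upsilon$, $\mathrm{Scope}_E(\Upsilon,N)$ is obtained from $\Upsilon$ by replacing each unbounded $\forall v$ by $\forall v<E(N)$ and each unbounded $\exists v$ by $\exists v<E(N)$, leaving the bounded quantifiers of the $\Delta_0^\xi$ part unchanged. A $\Pi_1^\xi$ or $\Sigma_1^\xi$ sentence $\Upsilon$ is $\mathrm{Good}(N)$ when $\mathrm{Scope}_E(\Upsilon,N)$ is true in Standard-M ($\mathrm{Good}(\infty)$ means true in Standard-M). For a set $\theta$ of $\Pi_1^\xi$ sentences, $\sharp(\theta)$ is the largest integer $J$ such that every sentence of $\theta$ is $\mathrm{Good}(J)$, and $\sharp(\theta)=\infty$ if this holds for all $J$. **Stability.** $\mathrm{RE\text{-}Class}(\xi)$ is the set of all recursively enumerable sets $\theta$ of $\Pi_1^\xi$ sentences (true or not). - $\xi$ is A-stable iff for every $\theta\in\mathrm{RE\text{-}Class}(\xi)$: if $\Upsilon$ is a $\Pi_1^\xi$ theorem of $\theta\cup B^\xi$ via a proof $p$ with $\mathrm{Log}(p)\le\sharp(\theta)+1$, then $\Upsilon$ is $\mathrm{Good}\{\tfrac12\sharp(\theta)\}$. - $\xi$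 is E-stable iff for every $\theta\in\mathrm{RE\text{-}Class}(\xi)$: if $\Upsilon$ is a $\Sigma_1^\xi$ theorem of $\theta\cup B^\xi$ via a proof $p$ with $\mathrm{Log}(p)\le\sharp(\theta)+1$, then $\Upsilon$ is $\mathrm{Good}\{\tfrac12\lfloor\mathrm{Log}(p)\rfloor-1\}$. - $\xi$ is EA-stable iff it is both E-stable and A-stable. **Self-consistency axioms.** An axiom system $\alpha\supseteq B^\xi$ is Level$(k^\xi)$ consistent when there are no proofs from $\alpha$ via $d$ of both a $\Pi_k^\xi$ sentence and the $\Sigma_k^\xi$ sentence that is its negation. For $\beta\supseteq B^\xi$, $\mathrm{SelfCons}^k(\beta,d)$ is a self-referencing $\Pi_1^\xi$ sentence asserting the Level$(k^\xi)$ consistency of $\beta+\mathrm{SelfCons}^k(\beta,d)$. Explicitly, use $\Delta_0^\xi$ formulas: $\mathrm{Neg}^k(x,y)$: $x$ is the Gödel number of a $\Pi_k^\xi$ sentence and $y$ that of the $\Sigma_k^\xi$ sentence which is its negation; $\mathrm{SubstPrf}^d_\beta(g,t,p)$: there is $h$ such that $h$ encodes the sentence obtained from the formula with code $g$ by replacing its free variables by the numeral $\bar g$, and $p$ is a proof of $t$ via $d$ from $\beta$ together with the sentence coded by $h$. Let $\Gamma^k(g)$ be $\forall x\forall y\forall p\forall q\ \neg\{\mathrm{Neg}^k(x,y)\wedge\mathrm{SubstPrf}^d_\beta(g,x,p)\wedge\mathrm{SubstPrf}^d_\beta(g,y,q)\}$ and $n$ its Gödel number; then $\mathrm{SelfCons}^k(\beta,d)$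 is $\Gamma^k(\bar n)$. **Self-justification.** A pair $(\alpha,d)$ (axiom system, deduction method) is self-justifying when (i) one of $\alpha$'s theorems states that $d$, applied to $\alpha$, produces a consistent set of theorems, and (ii) $\alpha$ is in fact consistent. *)

theory Defs
  imports Complex_Main "HOL-Library.Extended_Real"
begin

section \<open>First-order syntax\<close>

text \<open>
  Variables are de Bruijn indices; \<open>'f\<close> and \<open>'r\<close> are the types of function symbols (constants have
  arity 0) and of relation symbols other than \<open>=\<close> and \<open>\<le>\<close>.  The bounded quantifiers
  \<open>BAll T \<phi>\<close> and \<open>BEx T \<phi>\<close> are primitive; the bound \<open>T\<close> lies outside the scope of the variable they bind.
\<close>

datatype 'f trm = Var nat | Fn 'f "'f trm list"

datatype ('f, 'r) fm =
    Eq "'f trm" "'f trm"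
  | Le "'f trm" "'f trm"
  | Rel 'r "'f trm list"
  | Neg "('f, 'r) fm"
  | Conj "('f, 'r) fm" "('f, 'r) fm"
  | Disj "('f, 'r) fm" "('f, 'r) fm"
  | Impl "('f, 'r) fm" "('f, 'r) fm"
  | All "('f, 'r) fm"
  | Ex "('f, 'r) fm"
  | BAll "'f trm" "('f, 'r) fm"
  | BEx "'f trm" "('f, 'r) fm"

primrec tsubst :: "(nat \<Rightarrow> 'f trm) \<Rightarrow> 'f trm \<Rightarrow> 'f trm" where
  "tsubst s (Var i) = s i"
| "tsubst s (Fn f ts) = Fn f (map (tsubst s) ts)"

definition up :: "(nat \<Rightarrow> 'f trm) \<Rightarrow> nat \<Rightarrow> 'f trm" where
  "up s = case_nat (Var 0) (\<lambda>i. tsubst (\<lambda>j. Var (Suc j)) (s i))"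

primrec subst :: "('f, 'r) fm \<Rightarrow> (nat \<Rightarrow> 'f trm) \<Rightarrow> ('f, 'r) fm" where
  "subst (Eq t u) s = Eq (tsubst s t) (tsubst s u)"
| "subst (Le t u) s = Le (tsubst s t) (tsubst s u)"
| "subst (Rel r ts) s = Rel r (map (tsubst s) ts)"
| "subst (Neg \<phi>) s = Neg (subst \<phi> s)"
| "subst (Conj \<phi> \<psi>) s = Conj (subst \<phi> s) (subst \<psi> s)"
| "subst (Disj \<phi> \<psi>) s = Disj (subst \<phi> s) (subst \<psi> s)"
| "subst (Impl \<phi> \<psi>) s = Impl (subst \<phi> s) (subst \<psi> s)"
| "subst (All \<phi>) s = All (subst \<phi> (up s))"
| "subst (Ex \<phi>) s = Ex (subst \<phi> (up s))"
| "subst (BAll t \<phi>) s = BAll (tsubst s t) (subst \<phi> (up s))"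
| "subst (BEx t \<phi>) s = BEx (tsubst s t) (subst \<phi> (up s))"

text \<open>\<open>inst \<phi> [t\<^sub>0, t\<^sub>1, \<dots>]\<close> is \<open>\<phi>(t\<^sub>0, t\<^sub>1, \<dots>)\<close>, the free variables of \<open>\<phi>\<close> being listed in index order.\<close>

definition inst :: "('f, 'r) fm \<Rightarrow> 'f trm list \<Rightarrow> ('f, 'r) fm" where
  "inst \<phi> ts = subst \<phi> (\<lambda>i. if i < length ts then ts ! i else Var i)"

abbreviation Lt :: "'f trm \<Rightarrow> 'f trm \<Rightarrow> ('f, 'r) fm" where
  "Lt t u \<equiv> Neg (Le u t)"

primrec fully_bounded :: "('f, 'r) fm \<Rightarrow> bool" where
  "fully_bounded (Eq t u) \<longleftrightarrow> True"
| "fully_bounded (Le t u) \<longleftrightarrow> True"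
| "fully_bounded (Rel r ts) \<longleftrightarrow> True"
| "fully_bounded (Neg \<phi>) \<longleftrightarrow> fully_bounded \<phi>"
| "fully_bounded (Conj \<phi> \<psi>) \<longleftrightarrow> fully_bounded \<phi> \<and> fully_bounded \<psi>"
| "fully_bounded (Disj \<phi> \<psi>) \<longleftrightarrow> fully_bounded \<phi> \<and> fully_bounded \<psi>"
| "fully_bounded (Impl \<phi> \<psi>) \<longleftrightarrow> fully_bounded \<phi> \<and> fully_bounded \<psi>"
| "fully_bounded (All \<phi>) \<longleftrightarrow> False"
| "fully_bounded (Ex \<phi>) \<longleftrightarrow> False"
| "fully_bounded (BAll t \<phi>) \<longleftrightarrow> fully_bounded \<phi>"
| "fully_bounded (BEx t \<phi>) \<longleftrightarrow> fully_bounded \<phi>"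

text \<open>
  Negation of a prenex formula, again in prenex form: dualise the unbounded quantifier prefix
  and negate the matrix.  It maps \<open>\<Pi>\<^sub>k\<close> to \<open>\<Sigma>\<^sub>k\<close> formulas since \<open>\<Delta>\<^sub>0\<close> is closed under \<open>Neg\<close>.
\<close>

fun prenex_neg :: "('f, 'r) fm \<Rightarrow> ('f, 'r) fm" where
  "prenex_neg (All \<phi>) = Ex (prenex_neg \<phi>)"
| "prenex_neg (Ex \<phi>) = All (prenex_neg \<phi>)"
| "prenex_neg \<phi> = Neg \<phi>"


section \<open>Structures and truth\<close>

record ('f, 'r, 'u) struct =
  univ :: "'u set"
  fint :: "'f \<Rightarrow> 'u list \<Rightarrow> 'u"
  rint :: "'r \<Rightarrow> 'u list \<Rightarrow> bool"
  leint :: "'u \<Rightarrow> 'u \<Rightarrow> bool"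

primrec tval :: "('f, 'r, 'u) struct \<Rightarrow> (nat \<Rightarrow> 'u) \<Rightarrow> 'f trm \<Rightarrow> 'u" where
  "tval M e (Var i) = e i"
| "tval M e (Fn f ts) = fint M f (map (tval M e) ts)"

primrec sat :: "('f, 'r, 'u) struct \<Rightarrow> ('f, 'r) fm \<Rightarrow> (nat \<Rightarrow> 'u) \<Rightarrow> bool" where
  "sat M (Eq t u) e \<longleftrightarrow> tval M e t = tval M e u"
| "sat M (Le t u) e \<longleftrightarrow> leint M (tval M e t) (tval M e u)"
| "sat M (Rel r ts) e \<longleftrightarrow> rint M r (map (tval M e) ts)"
| "sat M (Neg \<phi>) e \<longleftrightarrow> \<not> sat M \<phi> e"
| "sat M (Conj \<phi> \<psi>) e \<longleftrightarrow> sat M \<phi> e \<and> sat M \<psi> e"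
| "sat M (Disj \<phi> \<psi>) e \<longleftrightarrow> sat M \<phi> e \<or> sat M \<psi> e"
| "sat M (Impl \<phi> \<psi>) e \<longleftrightarrow> (sat M \<phi> e \<longrightarrow> sat M \<psi> e)"
| "sat M (All \<phi>) e \<longleftrightarrow> (\<forall>a\<in>univ M. sat M \<phi> (case_nat a e))"
| "sat M (Ex \<phi>) e \<longleftrightarrow> (\<exists>a\<in>univ M. sat M \<phi> (case_nat a e))"
| "sat M (BAll t \<phi>) e \<longleftrightarrow> (\<forall>a\<in>univ M. leint M a (tval M e t) \<longrightarrow> sat M \<phi> (case_nat a e))"
| "sat M (BEx t \<phi>) e \<longleftrightarrow> (\<exists>a\<in>univ M. leint M a (tval M e t) \<and> sat M \<phi> (case_nat a e))"


section \<open>Configurations\<close>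

text \<open>
  A language comes with the intended meaning \<open>fval\<close>, \<open>rval\<close> of its symbols over the natural numbers
  and with a term \<open>numt k\<close> (the \<open>T\<^sub>k\<close> of the text, serving as the numeral of \<open>k\<close>) for every \<open>k\<close>.
\<close>

record ('f, 'r) language =
  farity :: "'f \<Rightarrow> nat"
  rarity :: "'r \<Rightarrow> nat"
  sym0 :: 'f
  sym1 :: 'f
  sym2 :: 'f
  symMax :: 'f
  fval :: "'f \<Rightarrow> nat list \<Rightarrow> nat"
  rval :: "'r \<Rightarrow> nat list \<Rightarrow> bool"
  numt :: "nat \<Rightarrow> 'f trm"

text \<open>
  \<open>Ded \<xi> \<alpha> \<pi> X\<close> means that the proof object \<open>\<pi>\<close> is a proof of \<open>X\<close> from \<open>\<alpha>\<close> via \<open>d\<close>.  The encoding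
  method \<open>G\<close> consists of Goedel numberings of formulas (\<open>gnum\<close>) and of proof objects (\<open>pnum\<close>).
\<close>

record ('f, 'r, 'p) config =
  Lang :: "('f, 'r) language"
  Delta0 :: "('f, 'r) fm set"
  Base :: "('f, 'r) fm set"
  Ded :: "('f, 'r) fm set \<Rightarrow> 'p \<Rightarrow> ('f, 'r) fm \<Rightarrow> bool"
  gnum :: "('f, 'r) fm \<Rightarrow> nat"
  pnum :: "'p \<Rightarrow> nat"

text \<open>Well-formedness with all free variables among \<open>0, \<dots>, n - 1\<close>.\<close>

primrec wf_trm :: "('f, 'r) language \<Rightarrow> nat \<Rightarrow> 'f trm \<Rightarrow> bool" where
  "wf_trm L n (Var i) \<longleftrightarrow> i < n"
| "wf_trm L n (Fn f ts) \<longleftrightarrow> length ts = farity L f \<and> list_all (wf_trm L n) ts"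

primrec wf_fm :: "('f, 'r) language \<Rightarrow> ('f, 'r) fm \<Rightarrow> nat \<Rightarrow> bool" where
  "wf_fm L (Eq t u) n \<longleftrightarrow> wf_trm L n t \<and> wf_trm L n u"
| "wf_fm L (Le t u) n \<longleftrightarrow> wf_trm L n t \<and> wf_trm L n u"
| "wf_fm L (Rel r ts) n \<longleftrightarrow> length ts = rarity L r \<and> list_all (wf_trm L n) ts"
| "wf_fm L (Neg \<phi>) n \<longleftrightarrow> wf_fm L \<phi> n"
| "wf_fm L (Conj \<phi> \<psi>) n \<longleftrightarrow> wf_fm L \<phi> n \<and> wf_fm L \<psi> n"
| "wf_fm L (Disj \<phi> \<psi>) n \<longleftrightarrow> wf_fm L \<phi> n \<and> wf_fm L \<psi> n"
| "wf_fm L (Impl \<phi> \<psi>) n \<longleftrightarrow> wf_fm L \<phi> n \<and> wf_fm L \<psi> n"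
| "wf_fm L (All \<phi>) n \<longleftrightarrow> wf_fm L \<phi> (Suc n)"
| "wf_fm L (Ex \<phi>) n \<longleftrightarrow> wf_fm L \<phi> (Suc n)"
| "wf_fm L (BAll t \<phi>) n \<longleftrightarrow> wf_trm L n t \<and> wf_fm L \<phi> (Suc n)"
| "wf_fm L (BEx t \<phi>) n \<longleftrightarrow> wf_trm L n t \<and> wf_fm L \<phi> (Suc n)"

definition formula :: "('f, 'r) language \<Rightarrow> ('f, 'r) fm \<Rightarrow> bool" where
  "formula L \<phi> \<longleftrightarrow> (\<exists>n. wf_fm L \<phi> n)"

definition sentence :: "('f, 'r) language \<Rightarrow> ('f, 'r) fm \<Rightarrow> bool" where
  "sentence L \<phi> \<longleftrightarrow> wf_fm L \<phi> 0"

definition Std :: "('f, 'r) language \<Rightarrow> ('f, 'r, nat) struct" where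
  "Std L = \<lparr>univ = UNIV, fint = fval L, rint = rval L, leint = (\<le>)\<rparr>"

text \<open>Truth in Standard-M; for sentences the assignment is irrelevant.\<close>

definition true_std :: "('f, 'r) language \<Rightarrow> ('f, 'r) fm \<Rightarrow> bool" where
  "true_std L \<phi> \<longleftrightarrow> sat (Std L) \<phi> (\<lambda>_. 0)"

text \<open>
  Logical validity.  The languages of generic configurations are countable (their formulas have
  Goedel numbers), so by the Loewenheim-Skolem theorem it suffices to consider structures
  whose universe is a nonempty set of natural numbers.
\<close>

definition valid :: "('f, 'r) language \<Rightarrow> ('f, 'r) fm \<Rightarrow> bool" where
  "valid L \<phi> \<longleftrightarrow>
     (\<forall>(M :: ('f, 'r, nat) struct) e.
        univ M \<noteq> {} \<and>
        (\<forall>f as. length as = farity L f \<and> set as \<subseteq> univ M \<longrightarrow> fint M f as \<in> univ M) \<and>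
        range e \<subseteq> univ M
        \<longrightarrow> sat M \<phi> e)"

fun Pi_cls Sigma_cls :: "('f, 'r, 'p) config \<Rightarrow> nat \<Rightarrow> ('f, 'r) fm set" where
  "Pi_cls \<xi> 0 = Delta0 \<xi>"
| "Sigma_cls \<xi> 0 = Delta0 \<xi>"
| "Pi_cls \<xi> (Suc n) = {(All ^^ k) \<phi> | k \<phi>. \<phi> \<in> Sigma_cls \<xi> n}"
| "Sigma_cls \<xi> (Suc n) = {(Ex ^^ k) \<phi> | k \<phi>. \<phi> \<in> Pi_cls \<xi> n}"

definition Pi_sentence :: "('f, 'r, 'p) config \<Rightarrow> nat \<Rightarrow> ('f, 'r) fm \<Rightarrow> bool" where
  "Pi_sentence \<xi> k \<phi> \<longleftrightarrow> sentence (Lang \<xi>) \<phi> \<and> \<phi> \<in> Pi_cls \<xi> k"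

definition Sigma_sentence :: "('f, 'r, 'p) config \<Rightarrow> nat \<Rightarrow> ('f, 'r) fm \<Rightarrow> bool" where
  "Sigma_sentence \<xi> k \<phi> \<longleftrightarrow> sentence (Lang \<xi>) \<phi> \<and> \<phi> \<in> Sigma_cls \<xi> k"

definition proof_of :: "('f, 'r, 'p) config \<Rightarrow> ('f, 'r) fm set \<Rightarrow> nat \<Rightarrow> ('f, 'r) fm \<Rightarrow> bool" where
  "proof_of \<xi> \<alpha> p X \<longleftrightarrow> (\<exists>\<pi>. pnum \<xi> \<pi> = p \<and> Ded \<xi> \<alpha> \<pi> X)"

definition provable :: "('f, 'r, 'p) config \<Rightarrow> ('f, 'r) fm set \<Rightarrow> ('f, 'r) fm \<Rightarrow> bool" where
  "provable \<xi> \<alpha> X \<longleftrightarrow> (\<exists>p. proof_of \<xi> \<alpha> p X)"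

definition axiom_system :: "('f, 'r, 'p) config \<Rightarrow> ('f, 'r) fm set \<Rightarrow> bool" where
  "axiom_system \<xi> \<alpha> \<longleftrightarrow> (\<forall>\<phi>\<in>\<alpha>. sentence (Lang \<xi>) \<phi>)"

definition language_ok :: "('f, 'r) language \<Rightarrow> bool" where
  "language_ok L \<longleftrightarrow>
     farity L (sym0 L) = 0 \<and> fval L (sym0 L) [] = 0 \<and>
     farity L (sym1 L) = 0 \<and> fval L (sym1 L) [] = 1 \<and>
     farity L (sym2 L) = 0 \<and> fval L (sym2 L) [] = 2 \<and>
     farity L (symMax L) = 2 \<and> (\<forall>x y. fval L (symMax L) [x, y] = max x y) \<and>
     (\<forall>k. wf_trm L 0 (numt L k) \<and> tval (Std L) (\<lambda>_. 0) (numt L k) = k)"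

definition Delta0_ok :: "('f, 'r, 'p) config \<Rightarrow> bool" where
  "Delta0_ok \<xi> \<longleftrightarrow>
     (\<forall>\<phi>\<in>Delta0 \<xi>. formula (Lang \<xi>) \<phi> \<and> fully_bounded \<phi> \<and> Neg \<phi> \<in> Delta0 \<xi>) \<and>
     (\<exists>Add\<in>Delta0 \<xi>. wf_fm (Lang \<xi>) Add 3 \<and>
        (\<forall>e. sat (Std (Lang \<xi>)) Add e \<longleftrightarrow> e 0 + e 1 = e 2)) \<and>
     (\<exists>Mult\<in>Delta0 \<xi>. wf_fm (Lang \<xi>) Mult 3 \<and>
        (\<forall>e. sat (Std (Lang \<xi>)) Mult e \<longleftrightarrow> e 0 * e 1 = e 2))"

definition Base_ok :: "('f, 'r, 'p) config \<Rightarrow> bool" where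
  "Base_ok \<xi> \<longleftrightarrow>
     axiom_system \<xi> (Base \<xi>) \<and>
     (\<forall>\<phi>\<in>Base \<xi>. true_std (Lang \<xi>) \<phi>) \<and>
     (\<forall>\<phi>. Sigma_sentence \<xi> 1 \<phi> \<and> true_std (Lang \<xi>) \<phi> \<longrightarrow> provable \<xi> (Base \<xi>) \<phi>) \<and>
     (\<forall>\<phi>. Pi_sentence \<xi> 1 \<phi> \<and> \<not> true_std (Lang \<xi>) \<phi> \<longrightarrow> provable \<xi> (Base \<xi>) (Neg \<phi>))"

text \<open>
  A deduction method proves the axioms it is given and the logically valid sentences, and has the
  indirect-implication property (whence it proves all logical consequences of the axioms).
  Neither soundness nor a modus ponens rule is demanded.
\<close>

definition Ded_ok :: "('f, 'r, 'p) config \<Rightarrow> bool" where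
  "Ded_ok \<xi> \<longleftrightarrow>
     (\<forall>\<alpha>. axiom_system \<xi> \<alpha> \<longrightarrow>
        (\<forall>X\<in>\<alpha>. provable \<xi> \<alpha> X) \<and>
        (\<forall>X. sentence (Lang \<xi>) X \<and> valid (Lang \<xi>) X \<longrightarrow> provable \<xi> \<alpha> X) \<and>
        (\<forall>X Y Z. sentence (Lang \<xi>) X \<and> sentence (Lang \<xi>) Y \<and> sentence (Lang \<xi>) Z \<and>
           provable \<xi> \<alpha> X \<and> provable \<xi> \<alpha> Y \<and> provable \<xi> \<alpha> (Impl (Conj X Y) Z)
           \<longrightarrow> provable \<xi> \<alpha> Z))"

text \<open>Goedel numbers of proofs are positive, so that their logarithm is defined.\<close>

definition encoding_ok :: "('f, 'r, 'p) config \<Rightarrow> bool" where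
  "encoding_ok \<xi> \<longleftrightarrow>
     inj_on (gnum \<xi>) {\<phi>. formula (Lang \<xi>) \<phi>} \<and> inj (pnum \<xi>) \<and> (\<forall>\<pi>. pnum \<xi> \<pi> > 0)"

definition generic_config :: "('f, 'r, 'p) config \<Rightarrow> bool" where
  "generic_config \<xi> \<longleftrightarrow>
     language_ok (Lang \<xi>) \<and> Delta0_ok \<xi> \<and> Base_ok \<xi> \<and> Ded_ok \<xi> \<and> encoding_ok \<xi>"


section \<open>Goodness\<close>

text \<open>
  The argument \<open>N\<close> may be a half-integer or negative; as variables range over the natural numbers,
  \<open>v < 2\<^sup>N\<close> is the same as \<open>v < \<lceil>2\<^sup>N\<rceil>\<close>.
\<close>

definition E_term :: "('f, 'r) language \<Rightarrow> real \<Rightarrow> 'f trm" where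
  "E_term L N = numt L (nat \<lceil>2 powr N\<rceil>)"

fun Scope :: "('f, 'r) language \<Rightarrow> ('f, 'r) fm \<Rightarrow> real \<Rightarrow> ('f, 'r) fm" where
  "Scope L (All \<phi>) N = All (Impl (Lt (Var 0) (E_term L N)) (Scope L \<phi> N))"
| "Scope L (Ex \<phi>) N = Ex (Conj (Lt (Var 0) (E_term L N)) (Scope L \<phi> N))"
| "Scope L \<phi> N = \<phi>"

text \<open>
  \<open>Good(-\<infinity>)\<close> has no meaning of its own; it never matters below, because a proof \<open>p\<close> with
  \<open>Log(p) \<le> -\<infinity>\<close> does not exist.
\<close>

fun Good :: "('f, 'r) language \<Rightarrow> ereal \<Rightarrow> ('f, 'r) fm \<Rightarrow> bool" where
  "Good L (ereal N) \<phi> \<longleftrightarrow> true_std L (Scope L \<phi> N)"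
| "Good L PInfty \<phi> \<longleftrightarrow> true_std L \<phi>"
| "Good L MInfty \<phi> \<longleftrightarrow> True"

text \<open>If no integer \<open>J\<close> at all qualifies (some sentence fails already at \<open>0\<close>), the value is \<open>-\<infinity>\<close>.\<close>

definition sharp :: "('f, 'r) language \<Rightarrow> ('f, 'r) fm set \<Rightarrow> ereal" where
  "sharp L \<theta> =
     (let ok = (\<lambda>J::int. \<forall>\<phi>\<in>\<theta>. Good L (ereal (of_int J)) \<phi>) in
      if \<forall>J. ok J then \<infinity>
      else if \<exists>J. ok J then ereal (of_int (GREATEST J. ok J))
      else -\<infinity>)"


section \<open>Recursively enumerable sets\<close>

datatype recf = Zero | Succ | Proj nat | Comp recf "recf list" | PrimRec recf recf | Mu recf

inductive computes :: "recf \<Rightarrow> nat list \<Rightarrow> nat \<Rightarrow> bool" where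
  "computes Zero xs 0"
| "computes Succ (x # xs) (Suc x)"
| "i < length xs \<Longrightarrow> computes (Proj i) xs (xs ! i)"
| "length ys = length gs \<Longrightarrow> \<forall>i<length gs. computes (gs ! i) xs (ys ! i) \<Longrightarrow> computes f ys z
    \<Longrightarrow> computes (Comp f gs) xs z"
| "computes f xs y \<Longrightarrow> computes (PrimRec f g) (0 # xs) y"
| "computes (PrimRec f g) (n # xs) y \<Longrightarrow> computes g (n # y # xs) z
    \<Longrightarrow> computes (PrimRec f g) (Suc n # xs) z"
| "computes f (n # xs) 0 \<Longrightarrow> \<forall>m<n. \<exists>y. computes f (m # xs) (Suc y) \<Longrightarrow> computes (Mu f) xs n"

definition rec_enumerable :: "nat set \<Rightarrow> bool" where
  "rec_enumerable A \<longleftrightarrow> (\<exists>f. A = {n. \<exists>y. computes f [n] y})"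

definition RE_Class :: "('f, 'r, 'p) config \<Rightarrow> ('f, 'r) fm set set" where
  "RE_Class \<xi> = {\<theta>. (\<forall>\<phi>\<in>\<theta>. Pi_sentence \<xi> 1 \<phi>) \<and> rec_enumerable (gnum \<xi> ` \<theta>)}"


section \<open>Stability\<close>

definition Log :: "nat \<Rightarrow> real" where
  "Log p = log 2 (real p)"

definition A_stable :: "('f, 'r, 'p) config \<Rightarrow> bool" where
  "A_stable \<xi> \<longleftrightarrow>
     (\<forall>\<theta>\<in>RE_Class \<xi>. \<forall>\<Upsilon> p.
        Pi_sentence \<xi> 1 \<Upsilon> \<and> proof_of \<xi> (\<theta> \<union> Base \<xi>) p \<Upsilon> \<and>
        ereal (Log p) \<le> sharp (Lang \<xi>) \<theta> + 1
        \<longrightarrow> Good (Lang \<xi>) (sharp (Lang \<xi>) \<theta> / 2) \<Upsilon>)"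

definition E_stable :: "('f, 'r, 'p) config \<Rightarrow> bool" where
  "E_stable \<xi> \<longleftrightarrow>
     (\<forall>\<theta>\<in>RE_Class \<xi>. \<forall>\<Upsilon> p.
        Sigma_sentence \<xi> 1 \<Upsilon> \<and> proof_of \<xi> (\<theta> \<union> Base \<xi>) p \<Upsilon> \<and>
        ereal (Log p) \<le> sharp (Lang \<xi>) \<theta> + 1
        \<longrightarrow> Good (Lang \<xi>) (ereal (of_int \<lfloor>Log p\<rfloor> / 2 - 1)) \<Upsilon>)"

definition EA_stable :: "('f, 'r, 'p) config \<Rightarrow> bool" where
  "EA_stable \<xi> \<longleftrightarrow> E_stable \<xi> \<and> A_stable \<xi>"


section \<open>Self-consistency axioms\<close>

definition Neg_rel :: "('f, 'r, 'p) config \<Rightarrow> nat \<Rightarrow> nat \<Rightarrow> nat \<Rightarrow> bool" where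
  "Neg_rel \<xi> k x y \<longleftrightarrow>
     (\<exists>\<phi>. Pi_sentence \<xi> k \<phi> \<and> gnum \<xi> \<phi> = x \<and> gnum \<xi> (prenex_neg \<phi>) = y)"

definition Prf_rel :: "('f, 'r, 'p) config \<Rightarrow> ('f, 'r) fm set \<Rightarrow> nat \<Rightarrow> nat \<Rightarrow> bool" where
  "Prf_rel \<xi> \<alpha> t p \<longleftrightarrow> (\<exists>X. sentence (Lang \<xi>) X \<and> gnum \<xi> X = t \<and> proof_of \<xi> \<alpha> p X)"

text \<open>All free variables of \<open>\<phi>\<close> are replaced by the numeral of the Goedel number of \<open>\<phi>\<close>.\<close>

definition diag :: "('f, 'r, 'p) config \<Rightarrow> ('f, 'r) fm \<Rightarrow> ('f, 'r) fm" where
  "diag \<xi> \<phi> = subst \<phi> (\<lambda>_. numt (Lang \<xi>) (gnum \<xi> \<phi>))"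

definition SubstPrf_rel ::
  "('f, 'r, 'p) config \<Rightarrow> ('f, 'r) fm set \<Rightarrow> nat \<Rightarrow> nat \<Rightarrow> nat \<Rightarrow> bool" where
  "SubstPrf_rel \<xi> \<beta> g t p \<longleftrightarrow>
     (\<exists>\<phi>. formula (Lang \<xi>) \<phi> \<and> gnum \<xi> \<phi> = g \<and> Prf_rel \<xi> (\<beta> \<union> {diag \<xi> \<phi>}) t p)"

text \<open>
  \<open>Gamma \<nu> \<sigma>\<close> is \<open>\<forall>x \<forall>y \<forall>p \<forall>q. \<not> {\<nu>(x, y) \<and> \<sigma>(g, x, p) \<and> \<sigma>(g, y, q)}\<close>; inside the quantifiers
  the indices of \<open>q, p, y, x, g\<close> are \<open>0, 1, 2, 3, 4\<close>.
\<close>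

definition Gamma :: "('f, 'r) fm \<Rightarrow> ('f, 'r) fm \<Rightarrow> ('f, 'r) fm" where
  "Gamma \<nu> \<sigma> = All (All (All (All (Neg
     (Conj (inst \<nu> [Var 3, Var 2])
        (Conj (inst \<sigma> [Var 4, Var 3, Var 1]) (inst \<sigma> [Var 4, Var 2, Var 0])))))))"

text \<open>
  \<open>S\<close> is \<open>SelfCons\<^sup>k(\<beta>, d)\<close>, constructed from some \<open>\<Delta>\<^sub>0\<close> formulas \<open>\<nu>(x, y)\<close> and \<open>\<sigma>(g, t, p)\<close> that
  define the relations \<open>Neg\<^sup>k\<close> and \<open>SubstPrf\<close>.  That \<open>S\<close> is \<open>\<Pi>\<^sub>1\<close> has to be required: \<open>\<Delta>\<^sub>0\<close> is not assumed
  closed under conjunction and substitution.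
\<close>

definition is_SelfCons ::
  "('f, 'r, 'p) config \<Rightarrow> nat \<Rightarrow> ('f, 'r) fm set \<Rightarrow> ('f, 'r) fm \<Rightarrow> bool" where
  "is_SelfCons \<xi> k \<beta> S \<longleftrightarrow>
     (\<exists>\<nu>\<in>Delta0 \<xi>. \<exists>\<sigma>\<in>Delta0 \<xi>.
        wf_fm (Lang \<xi>) \<nu> 2 \<and>
        (\<forall>e. sat (Std (Lang \<xi>)) \<nu> e \<longleftrightarrow> Neg_rel \<xi> k (e 0) (e 1)) \<and>
        wf_fm (Lang \<xi>) \<sigma> 3 \<and>
        (\<forall>e. sat (Std (Lang \<xi>)) \<sigma> e \<longleftrightarrow> SubstPrf_rel \<xi> \<beta> (e 0) (e 1) (e 2)) \<and>
        S = diag \<xi> (Gamma \<nu> \<sigma>) \<and>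
        Pi_sentence \<xi> 1 S)"


section \<open>Self-justification\<close>

definition consistent :: "('f, 'r, 'p) config \<Rightarrow> ('f, 'r) fm set \<Rightarrow> bool" where
  "consistent \<xi> \<alpha> \<longleftrightarrow>
     \<not> (\<exists>X. sentence (Lang \<xi>) X \<and> provable \<xi> \<alpha> X \<and> provable \<xi> \<alpha> (Neg X))"

text \<open>
  \<open>\<Psi>\<close> literally says \<open>\<forall>x \<forall>y \<forall>p \<forall>q. \<not> {\<nu>(x, y) \<and> \<pi>(x, p) \<and> \<pi>(y, q)}\<close>, where \<open>\<nu>\<close> defines \<open>Neg\<^sup>k\<close> and
  \<open>\<pi>(t, p)\<close> defines ``\<open>p\<close> is a proof of \<open>t\<close> from \<open>\<alpha>\<close> via \<open>d\<close>''.  A merely truth-functional reading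
  (``\<open>\<Psi>\<close> is true iff \<open>\<alpha>\<close> is Level-\<open>k\<close> consistent'') would be met by any true sentence when
  \<open>\<alpha>\<close> is consistent.
\<close>

definition states_consistency ::
  "('f, 'r, 'p) config \<Rightarrow> nat \<Rightarrow> ('f, 'r) fm set \<Rightarrow> ('f, 'r) fm \<Rightarrow> bool" where
  "states_consistency \<xi> k \<alpha> \<Psi> \<longleftrightarrow>
     (\<exists>\<nu> \<pi>.
        wf_fm (Lang \<xi>) \<nu> 2 \<and>
        (\<forall>e. sat (Std (Lang \<xi>)) \<nu> e \<longleftrightarrow> Neg_rel \<xi> k (e 0) (e 1)) \<and>
        wf_fm (Lang \<xi>) \<pi> 2 \<and>
        (\<forall>e. sat (Std (Lang \<xi>)) \<pi> e \<longleftrightarrow> Prf_rel \<xi> \<alpha> (e 0) (e 1)) \<and>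
        \<Psi> = All (All (All (All (Neg
              (Conj (inst \<nu> [Var 3, Var 2])
                 (Conj (inst \<pi> [Var 3, Var 1]) (inst \<pi> [Var 2, Var 0]))))))))"

text \<open>
  The pair \<open>(\<alpha>, d)\<close> is self-justifying, \<open>\<Psi>\<close> being the theorem of \<open>\<alpha>\<close> that states the (Level-\<open>k\<close>)
  consistency of \<open>\<alpha>\<close>.  The theorem \<open>\<Psi>\<close> is a parameter, rather than existentially quantified, because
  contrived definitions of the proof relation make some consistency statement provable in
  practically every consistent system.
\<close>

definition self_justifying_via ::
  "('f, 'r, 'p) config \<Rightarrow> nat \<Rightarrow> ('f, 'r) fm set \<Rightarrow> ('f, 'r) fm \<Rightarrow> bool" where
  "self_justifying_via \<xi> k \<alpha> \<Psi> \<longleftrightarrow>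
     (provable \<xi> \<alpha> \<Psi> \<and> states_consistency \<xi> k \<alpha> \<Psi>) \<and> consistent \<xi> \<alpha>"

end

theory Submission
  imports Defs
begin

text \<open>
  If the system were inconsistent, it would prove \<open>S\<close> and its negation, so \<open>S\<close> would be false
  and have counterexamples \<open>(x, y, p, q)\<close>.  With \<open>J = \<sharp>{S}\<close>, some counterexample has all components
  below \<open>2\<^bsup>J+1\<^esup>\<close>; so \<open>p\<close> and \<open>q\<close> are short enough for stability.  A-stability
  makes the \<open>\<Pi>\<^sub>1\<close> sentence proved by \<open>p\<close> good up to \<open>J/2\<close>, while E-stability gives its negation,
  proved by \<open>q\<close>, a witness below \<open>2\<^bsup>J/2-1\<^esup>\<close>, which is absurd.
\<close>

section \<open>Substitution\<close>

lemma wf_trm_mono: "wf_trm L n t \<Longrightarrow> n \<le> m \<Longrightarrow> wf_trm L m t"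
  by (induction t) (auto simp: list_all_iff)

lemma tsubst_cong: "wf_trm L n t \<Longrightarrow> (\<And>i. i < n \<Longrightarrow> s i = s' i) \<Longrightarrow> tsubst s t = tsubst s' t"
  by (induction t) (auto simp: list_all_iff)

lemma up_simps [simp]: "up s 0 = Var 0" "up s (Suc i) = tsubst (\<lambda>j. Var (Suc j)) (s i)"
  by (simp_all add: up_def)

lemma up_cong:
  assumes "\<And>i. i < n \<Longrightarrow> s i = s' i" "i < Suc n"
  shows "up s i = up s' i"
  using assms by (cases i) simp_all

text \<open>Makes a comparison of two instances a check on finitely many indices. Under a binder the
  agreement on \<open>n\<close> indices extends to \<open>Suc n\<close>, because \<open>up\<close>
  fixes index 0 on both sides.\<close>

lemma subst_cong:
  assumes "wf_fm L \<phi> n" "\<And>i. i < n \<Longrightarrow> s i = s' i"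
  shows "subst \<phi> s = subst \<phi> s'"
proof -
  have "\<forall>i<n. s i = s' i" using assms(2) by blast
  with assms(1) show ?thesis
  proof (induction \<phi> arbitrary: n s s')
    case (Rel r ts)
    then show ?case by (auto simp: list_all_iff intro: tsubst_cong)
  next
    case (All \<phi>)
    have "\<forall>i<Suc n. up s i = up s' i"
      using All.prems(2) up_cong by blast
    from All.IH[OF _ this] show ?case using All.prems(1) by simp
  next
    case (Ex \<phi>)
    have "\<forall>i<Suc n. up s i = up s' i"
      using Ex.prems(2) up_cong by blast
    from Ex.IH[OF _ this] show ?case using Ex.prems(1) by simp
  next
    case (BAll t \<phi>)
    have "\<forall>i<Suc n. up s i = up s' i"
      using BAll.prems(2) up_cong by blast
    from BAll.IH[OF _ this] show ?case
      using BAll.prems tsubst_cong[of L n t s s'] by simp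
  next
    case (BEx t \<phi>)
    have "\<forall>i<Suc n. up s i = up s' i"
      using BEx.prems(2) up_cong by blast
    from BEx.IH[OF _ this] show ?case
      using BEx.prems tsubst_cong[of L n t s s'] by simp
  qed (simp; blast intro: tsubst_cong)+
qed

lemma tsubst_Var [simp]: "tsubst Var t = t"
  by (induction t) (auto simp: map_idI)

lemma tsubst_tsubst: "tsubst s (tsubst r t) = tsubst (\<lambda>i. tsubst s (r i)) t"
  by (induction t) auto

text \<open>The binder case of \<open>subst_subst\<close>: index 0 is fixed throughout, and
  elsewhere shifting and then applying \<open>up s\<close> agrees with applying \<open>s\<close> and
  then shifting.\<close>

lemma up_comp: "(\<lambda>i. tsubst (up s) (up r i)) = up (\<lambda>i. tsubst s (r i))"
proof
  show "tsubst (up s) (up r i) = up (\<lambda>i. tsubst s (r i)) i" for i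
    by (cases i) (simp_all add: tsubst_tsubst)
qed

lemma subst_subst: "subst (subst \<phi> r) s = subst \<phi> (\<lambda>i. tsubst s (r i))"
  by (induction \<phi> arbitrary: r s) (simp_all add: tsubst_tsubst up_comp)

lemma wf_tsubst:
  "wf_trm L n t \<Longrightarrow> (\<And>i. i < n \<Longrightarrow> wf_trm L m (s i)) \<Longrightarrow> wf_trm L m (tsubst s t)"
  by (induction t) (auto simp: list_all_iff)

lemma wf_up:
  assumes "\<And>i. i < n \<Longrightarrow> wf_trm L m (s i)" "i < Suc n"
  shows "wf_trm L (Suc m) (up s i)"
  using assms by (cases i) (auto intro!: wf_tsubst[where n = m])

lemma wf_subst:
  assumes "wf_fm L \<phi> n" "\<And>i. i < n \<Longrightarrow> wf_trm L m (s i)"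
  shows "wf_fm L (subst \<phi> s) m"
proof -
  have "\<forall>i<n. wf_trm L m (s i)" using assms(2) by blast
  with assms(1) show ?thesis
  proof (induction \<phi> arbitrary: n m s)
    case (Rel r ts)
    then show ?case by (auto simp: list_all_iff intro: wf_tsubst)
  next
    case (All \<phi>)
    have "\<forall>i<Suc n. wf_trm L (Suc m) (up s i)"
      using All.prems(2) wf_up by blast
    from All.IH[OF _ this] show ?case using All.prems(1) by simp
  next
    case (Ex \<phi>)
    have "\<forall>i<Suc n. wf_trm L (Suc m) (up s i)"
      using Ex.prems(2) wf_up by blast
    from Ex.IH[OF _ this] show ?case using Ex.prems(1) by simp
  next
    case (BAll t \<phi>)
    have "\<forall>i<Suc n. wf_trm L (Suc m) (up s i)"
      using BAll.prems(2) wf_up by blast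
    from BAll.IH[OF _ this] show ?case
      using BAll.prems wf_tsubst[of L n t m s] by simp
  next
    case (BEx t \<phi>)
    have "\<forall>i<Suc n. wf_trm L (Suc m) (up s i)"
      using BEx.prems(2) wf_up by blast
    from BEx.IH[OF _ this] show ?case
      using BEx.prems wf_tsubst[of L n t m s] by simp
  qed (simp; blast intro: wf_tsubst)+
qed

lemma wf_inst:
  assumes "wf_fm L \<phi> (length ts)" "\<And>t. t \<in> set ts \<Longrightarrow> wf_trm L m t"
  shows "wf_fm L (inst \<phi> ts) m"
  unfolding inst_def using assms by (auto intro!: wf_subst[where n = "length ts"])

lemma tval_cong: "wf_trm L n t \<Longrightarrow> (\<And>i. i < n \<Longrightarrow> e i = e' i) \<Longrightarrow> tval M e t = tval M e' t"
  by (induction t) (auto simp: list_all_iff intro!: arg_cong[where f = "fint M _"])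

lemma tval_tsubst: "tval M e (tsubst s t) = tval M (\<lambda>i. tval M e (s i)) t"
  by (induction t) (auto intro!: arg_cong[where f = "fint M _"])

lemma tval_up: "(\<lambda>i. tval M (case_nat a e) (up s i)) = case_nat a (\<lambda>i. tval M e (s i))"
proof
  show "tval M (case_nat a e) (up s i) = case_nat a (\<lambda>i. tval M e (s i)) i" for i
    by (cases i) (simp_all add: tval_tsubst)
qed

text \<open>The classical substitution lemma, whose quantifier cases are \<open>tval_up\<close>. It
  is the tool for evaluating the \<open>inst\<close> formulas below.\<close>

lemma sat_subst: "sat M (subst \<phi> s) e \<longleftrightarrow> sat M \<phi> (\<lambda>i. tval M e (s i))"
  by (induction \<phi> arbitrary: s e) (simp_all add: tval_tsubst tval_up comp_def)

lemma tsubst_closed: "wf_trm L 0 t \<Longrightarrow> tsubst s t = t"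
  using tsubst_cong[of L 0 t s Var] by simp


section \<open>Singletons are recursively enumerable\<close>

text \<open>\<open>eq_recf c\<close> computes a total function whose only zero is \<open>c\<close>.\<close>

primrec eq_recf :: "nat \<Rightarrow> recf" where
  "eq_recf 0 = PrimRec Zero (Comp Succ [Zero])"
| "eq_recf (Suc c) = PrimRec (Comp Succ [Zero]) (Comp (eq_recf c) [Proj 0])"

inductive_cases computes_CompE: "computes (Comp f gs) xs z"
inductive_cases computes_SuccE: "computes Succ xs z"
inductive_cases computes_ProjE: "computes (Proj i) xs z"
inductive_cases computes_PrimRec_0E: "computes (PrimRec f g) (0 # xs) z"
inductive_cases computes_PrimRec_SucE: "computes (PrimRec f g) (Suc n # xs) z"
inductive_cases computes_MuE: "computes (Mu f) xs z"

lemma computes_Comp1: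
  "computes g xs y \<Longrightarrow> computes f [y] z \<Longrightarrow> computes (Comp f [g]) xs z"
  by (rule computes.intros(4)[where ys = "[y]"]) auto

lemma computes_Comp1D:
  "computes (Comp f [g]) xs z \<Longrightarrow> \<exists>y. computes g xs y \<and> computes f [y] z"
  by (erule computes_CompE) (auto simp: length_Suc_conv)

lemma computes_const_Suc: "computes (Comp Succ [Zero]) xs (Suc 0)"
  using computes.intros(1) computes.intros(2) by (rule computes_Comp1)

lemma computes_Comp_Proj:
  assumes "i < length xs" "computes f [xs ! i] z"
  shows "computes (Comp f [Proj i]) xs z"
  using computes.intros(3)[OF assms(1)] assms(2) by (rule computes_Comp1)

lemma computes_Comp_ProjD: "computes (Comp f [Proj i]) xs z \<Longrightarrow> computes f [xs ! i] z"
  by (auto dest!: computes_Comp1D elim: computes_ProjE)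

lemma not_computes_const_Suc_0: "\<not> computes (Comp Succ [Zero]) xs 0"
  by (auto dest!: computes_Comp1D elim: computes_SuccE)

text \<open>Primitive recursion at \<open>Suc n\<close> demands a value at \<open>n\<close> even
  when the step function discards it; totality supplies that value.\<close>

lemma computes_eq_recf_total: "\<exists>y. computes (eq_recf c) [n] y"
proof (induction c arbitrary: n)
  case 0
  show ?case
  proof (induction n)
    case 0
    show ?case using computes.intros(5)[OF computes.intros(1)] by auto
  next
    case (Suc n)
    then show ?case using computes.intros(6)[OF _ computes_const_Suc] by fastforce
  qed
next
  case (Suc c)
  show ?case
  proof (induction n)
    case 0
    show ?case using computes.intros(5)[OF computes_const_Suc] by auto
  next
    case (Suc n)
    then obtain y where y: "computes (eq_recf (Suc c)) [n] y" by blast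
    obtain z where "computes (eq_recf c) [n] z" using \<open>\<And>n. \<exists>y. computes (eq_recf c) [n] y\<close> by blast
    then have "computes (Comp (eq_recf c) [Proj 0]) [n, y] z"
      by (intro computes_Comp_Proj) simp_all
    with y have "computes (eq_recf (Suc c)) [Suc n] z"
      unfolding eq_recf.simps by (rule computes.intros(6))
    then show ?case by blast
  qed
qed

lemma computes_eq_recf_self: "computes (eq_recf c) [c] 0"
proof (induction c)
  case 0
  show ?case unfolding eq_recf.simps by (intro computes.intros)
next
  case (Suc c)
  obtain y where y: "computes (eq_recf (Suc c)) [c] y" using computes_eq_recf_total by blast
  have "computes (Comp (eq_recf c) [Proj 0]) [c, y] 0"
    using Suc by (intro computes_Comp_Proj) simp_all
  with y show ?case unfolding eq_recf.simps by (rule computes.intros(6))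
qed

text \<open>When exactly one of \<open>c\<close> and \<open>n\<close> is 0 the computed value is the
  constant 1; when both are successors, the recursion strips one from each.\<close>

lemma computes_eq_recf_0D: "computes (eq_recf c) [n] 0 \<Longrightarrow> n = c"
proof (induction c arbitrary: n)
  case 0
  then show ?case
    by (cases n) (auto elim: computes_PrimRec_SucE simp: not_computes_const_Suc_0)
next
  case (Suc c)
  show ?case
  proof (cases n)
    case 0
    then show ?thesis using Suc.prems
      by (auto elim: computes_PrimRec_0E simp: not_computes_const_Suc_0)
  next
    case (Suc m)
    then have "computes (eq_recf c) [m] 0" using Suc.prems
      by (auto elim!: computes_PrimRec_SucE dest: computes_Comp_ProjD)
    then show ?thesis using Suc.IH Suc by blast
  qed
qed

text \<open>The singleton is the domain of an unbounded search whose test looks only at the input,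
  read by \<open>Proj 1\<close>: the search stops at 0 on input \<open>c\<close> and diverges
  elsewhere. Hence stability may be applied to a single axiom.\<close>

lemma rec_enumerable_singleton: "rec_enumerable {c}"
proof -
  let ?f = "Mu (Comp (eq_recf c) [Proj 1])"
  have "(\<exists>y. computes ?f [n] y) \<longleftrightarrow> n = c" for n
  proof
    assume "\<exists>y. computes ?f [n] y"
    then obtain y where "computes (Comp (eq_recf c) [Proj 1]) [y, n] 0"
      by (auto elim: computes_MuE)
    then show "n = c" using computes_Comp_ProjD computes_eq_recf_0D by fastforce
  next
    assume "n = c"
    then have "computes (Comp (eq_recf c) [Proj 1]) [0, n] 0"
      using computes_eq_recf_self by (intro computes_Comp_Proj) simp_all
    then have "computes ?f [n] 0" by (rule computes.intros(7)) simp
    then show "\<exists>y. computes ?f [n] y" ..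
  qed
  then show ?thesis unfolding rec_enumerable_def by (intro exI[of _ ?f]) auto
qed


section \<open>Goodness\<close>

lemma Std_simps [simp]: "univ (Std L) = UNIV" "leint (Std L) = (\<le>)"
  by (simp_all add: Std_def)

lemma tval_numt:
  assumes "language_ok L"
  shows "tval (Std L) e (numt L k) = k"
proof -
  have "wf_trm L 0 (numt L k)" and "tval (Std L) (\<lambda>_. 0) (numt L k) = k"
    using assms by (auto simp: language_ok_def)
  then show ?thesis using tval_cong[of L 0 "numt L k" e "\<lambda>_. 0" "Std L"] by simp
qed

lemma E_term_bound:
  assumes "language_ok L"
  shows "v < tval (Std L) e (E_term L N) \<longleftrightarrow> real v < 2 powr N"
  using assms by (simp add: E_term_def tval_numt zless_nat_eq_int_zless less_ceiling_iff)

lemma sat_Scope_All: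
  assumes "language_ok L"
  shows "sat (Std L) (Scope L (All \<phi>) N) e \<longleftrightarrow>
    (\<forall>a. real a < 2 powr N \<longrightarrow> sat (Std L) (Scope L \<phi> N) (case_nat a e))"
  using E_term_bound[OF assms] by (auto simp flip: not_less)

lemma sat_Scope_Ex:
  assumes "language_ok L"
  shows "sat (Std L) (Scope L (Ex \<phi>) N) e \<longleftrightarrow>
    (\<exists>a. real a < 2 powr N \<and> sat (Std L) (Scope L \<phi> N) (case_nat a e))"
  using E_term_bound[OF assms] by (auto simp flip: not_less)

lemma Scope_fully_bounded: "fully_bounded \<phi> \<Longrightarrow> Scope L \<phi> N = \<phi>"
  by (cases \<phi>) auto

lemma prenex_neg_fully_bounded: "fully_bounded \<phi> \<Longrightarrow> prenex_neg \<phi> = Neg \<phi>"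
  by (cases \<phi>) auto

lemma prenex_neg_funpow_All: "prenex_neg ((All ^^ k) \<phi>) = (Ex ^^ k) (prenex_neg \<phi>)"
  by (induction k) auto

lemma wf_prenex_neg: "wf_fm L \<phi> n \<Longrightarrow> wf_fm L (prenex_neg \<phi>) n"
  by (induction \<phi> arbitrary: n rule: prenex_neg.induct) auto

text \<open>Closure of \<open>Delta0\<close> under \<open>Neg\<close> keeps the negated matrix in
  \<open>Delta0\<close>; this makes E-stability applicable to the negation.\<close>

lemma Sigma_sentence_prenex_neg:
  assumes "Delta0_ok \<xi>" "Pi_sentence \<xi> 1 \<phi>"
  shows "Sigma_sentence \<xi> 1 (prenex_neg \<phi>)"
proof -
  obtain k \<phi>0 where \<phi>: "\<phi> = (All ^^ k) \<phi>0" "\<phi>0 \<in> Delta0 \<xi>"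
    using assms(2) by (auto simp: Pi_sentence_def)
  then have "fully_bounded \<phi>0" "Neg \<phi>0 \<in> Delta0 \<xi>" using assms(1) by (auto simp: Delta0_ok_def)
  then have "prenex_neg \<phi> \<in> Sigma_cls \<xi> 1"
    using \<phi> by (auto simp: prenex_neg_funpow_All prenex_neg_fully_bounded)
  then show ?thesis using assms(2) by (simp add: Sigma_sentence_def Pi_sentence_def sentence_def wf_prenex_neg)
qed

text \<open>A witness below \<open>2 powr N\<close> is also below \<open>2 powr N'\<close>, so the
  scoped universal quantifier applies to it. Peeling off the whole prefix leaves the matrix and its
  negation true together.\<close>

lemma sat_Scope_All_Ex_conflict:
  assumes L: "language_ok L" and "fully_bounded \<phi>" "N \<le> N'"
    and "sat (Std L) (Scope L ((All ^^ k) \<phi>) N') e"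
  shows "\<not> sat (Std L) (Scope L ((Ex ^^ k) (Neg \<phi>)) N) e"
  using assms(4)
proof (induction k arbitrary: e)
  case 0
  then show ?case using assms(2) by (simp add: Scope_fully_bounded)
next
  case (Suc k)
  have "(2::real) powr N \<le> 2 powr N'" using \<open>N \<le> N'\<close> by simp
  then show ?case
    using Suc unfolding funpow.simps comp_def sat_Scope_All[OF L] sat_Scope_Ex[OF L]
    by (meson less_le_trans)
qed

lemma Good_prenex_neg_conflict:
  assumes "language_ok (Lang \<xi>)" "Delta0_ok \<xi>" "Pi_sentence \<xi> 1 \<phi>" "N \<le> N'"
    and "Good (Lang \<xi>) (ereal N') \<phi>"
  shows "\<not> Good (Lang \<xi>) (ereal N) (prenex_neg \<phi>)"
proof -
  obtain k \<phi>0 where \<phi>: "\<phi> = (All ^^ k) \<phi>0" "\<phi>0 \<in> Delta0 \<xi>"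
    using assms(3) by (auto simp: Pi_sentence_def)
  then have "fully_bounded \<phi>0" using assms(2) by (auto simp: Delta0_ok_def)
  then show ?thesis using assms \<phi> sat_Scope_All_Ex_conflict[of "Lang \<xi>" \<phi>0 N N' k]
    by (auto simp: true_std_def prenex_neg_funpow_All prenex_neg_fully_bounded)
qed

lemma sharp_singleton:
  assumes "Good L (ereal (of_int J)) \<phi>"
    and "\<And>K. J < K \<Longrightarrow> \<not> Good L (ereal (of_int K)) \<phi>"
  shows "sharp L {\<phi>} = ereal (of_int J)"
proof -
  have "(GREATEST K. Good L (ereal (of_int K)) \<phi>) = J"
    using assms by (intro Greatest_equality) (auto simp flip: not_less simp del: Good.simps)
  moreover have "\<not> (\<forall>K::int. Good L (ereal (of_int K)) \<phi>)" using assms(2)[OF less_add_one] by blast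
  moreover have "\<exists>K::int. Good L (ereal (of_int K)) \<phi>" using assms(1) by blast
  ultimately show ?thesis by (simp add: sharp_def Let_def del: Good.simps)
qed


section \<open>The self-consistency sentence\<close>

text \<open>The only free variable is \<open>Var 4\<close> below four quantifiers, which is index 0
  outside them.\<close>

lemma wf_Gamma:
  assumes "wf_fm L \<nu> 2" "wf_fm L \<sigma> 3"
  shows "wf_fm L (Gamma \<nu> \<sigma>) 1"
  unfolding Gamma_def using assms by (auto intro!: wf_inst simp: numeral_eq_Suc)

text \<open>The numeral is closed, so it passes through the binders unchanged. Absorbing it into
  \<sigma> leaves a binary formula, which is the shape that \<open>states_consistency\<close> asks
  for.\<close>

lemma diag_Gamma:
  fixes \<xi> :: "('f, 'r, 'p) config"
  defines "L \<equiv> Lang \<xi>"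
  assumes "language_ok L" "wf_fm L \<nu> 2" "wf_fm L \<sigma> 3"
  shows "diag \<xi> (Gamma \<nu> \<sigma>) = All (All (All (All (Neg
     (Conj (inst \<nu> [Var 3, Var 2])
        (Conj (inst (inst \<sigma> [numt L (gnum \<xi> (Gamma \<nu> \<sigma>)), Var 0, Var 1]) [Var 3, Var 1])
              (inst (inst \<sigma> [numt L (gnum \<xi> (Gamma \<nu> \<sigma>)), Var 0, Var 1]) [Var 2, Var 0])))))))"
proof -
  define c where "c = numt L (gnum \<xi> (Gamma \<nu> \<sigma>))"
  have c: "tsubst s c = c" for s
    using assms(2) by (auto simp: c_def language_ok_def intro!: tsubst_closed)
  \<comment> \<open>This substitution fixes the quantified indices 0 to 3 and sends every larger
    index, in particular 4, to the numeral.\<close>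
  let ?s = "up (up (up (up (\<lambda>_. c))))"
  have \<nu>: "subst (inst \<nu> [Var 3, Var 2]) ?s = inst \<nu> [Var 3, Var 2]"
    unfolding inst_def subst_subst
    by (rule subst_cong[OF assms(3)]) (auto simp: c numeral_eq_Suc less_Suc_eq)
  have \<sigma>: "subst (inst \<sigma> [Var 4, Var i, Var j]) ?s = inst (inst \<sigma> [c, Var 0, Var 1]) [Var i, Var j]"
    if "i < 4" "j < 4" for i j
    unfolding inst_def subst_subst
    by (rule subst_cong[OF assms(4)]) (use that in \<open>auto simp: c numeral_eq_Suc less_Suc_eq\<close>)
  show ?thesis
    using \<nu> \<sigma> unfolding diag_def Gamma_def[of \<nu> \<sigma>] by (simp add: c_def L_def Gamma_def)
qed

definition conflict :: "('f, 'r, 'p) config \<Rightarrow> nat \<Rightarrow> ('f, 'r) fm set \<Rightarrow> nat \<Rightarrow> nat \<Rightarrow> nat \<Rightarrow> nat \<Rightarrow> bool"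
  where "conflict \<xi> k \<alpha> x y p q \<longleftrightarrow> Neg_rel \<xi> k x y \<and> Prf_rel \<xi> \<alpha> x p \<and> Prf_rel \<xi> \<alpha> y q"

text \<open>By injectivity of \<open>gnum\<close> the code determines the formula that is
  diagonalised.\<close>

lemma SubstPrf_rel_iff:
  assumes "encoding_ok \<xi>" "formula (Lang \<xi>) \<phi>"
  shows "SubstPrf_rel \<xi> \<beta> (gnum \<xi> \<phi>) t p \<longleftrightarrow> Prf_rel \<xi> (\<beta> \<union> {diag \<xi> \<phi>}) t p"
  using assms by (auto simp: SubstPrf_rel_def encoding_ok_def inj_on_def)

text \<open>This is where self-reference happens: with its first argument fixed to the code of
  \<open>Gamma \<nu> \<sigma>\<close>, the formula \<sigma> speaks about proofs from \<beta> plus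
  the diagonalisation of \<open>Gamma \<nu> \<sigma>\<close>, and that diagonalisation is
  \<open>S\<close> itself.\<close>

lemma SelfCons_states_consistency:
  assumes \<xi>: "generic_config \<xi>" and S: "is_SelfCons \<xi> k \<beta> S"
  shows "states_consistency \<xi> k (\<beta> \<union> {S}) S"
proof -
  let ?L = "Lang \<xi>"
  have L: "language_ok ?L" and enc: "encoding_ok \<xi>" using \<xi> by (auto simp: generic_config_def)
  obtain \<nu> \<sigma> where \<nu>: "wf_fm ?L \<nu> 2" "\<And>e. sat (Std ?L) \<nu> e \<longleftrightarrow> Neg_rel \<xi> k (e 0) (e 1)"
    and \<sigma>: "wf_fm ?L \<sigma> 3" "\<And>e. sat (Std ?L) \<sigma> e \<longleftrightarrow> SubstPrf_rel \<xi> \<beta> (e 0) (e 1) (e 2)"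
    and S: "S = diag \<xi> (Gamma \<nu> \<sigma>)"
    using S unfolding is_SelfCons_def by metis
  define c where "c = numt ?L (gnum \<xi> (Gamma \<nu> \<sigma>))"
  have fm: "formula ?L (Gamma \<nu> \<sigma>)" using wf_Gamma[OF \<nu>(1) \<sigma>(1)] by (auto simp: formula_def)
  have "wf_trm ?L 2 c"
    using L wf_trm_mono[of ?L 0 c 2] by (simp add: c_def language_ok_def)
  then have "wf_fm ?L (inst \<sigma> [c, Var 0, Var 1]) 2"
    using \<sigma>(1) by (intro wf_inst) (auto simp: numeral_eq_Suc)
  moreover have "sat (Std ?L) (inst \<sigma> [c, Var 0, Var 1]) e \<longleftrightarrow> Prf_rel \<xi> (\<beta> \<union> {S}) (e 0) (e 1)" for e
    using SubstPrf_rel_iff[OF enc fm]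
    by (simp add: inst_def sat_subst \<sigma>(2) S c_def tval_numt[OF L])
  ultimately show ?thesis
    unfolding states_consistency_def
    using \<nu> diag_Gamma[OF L \<nu>(1) \<sigma>(1)] S c_def by blast
qed

text \<open>Each of the four scoped quantifiers contributes one bound, so goodness becomes a
  statement about the size of counterexamples.\<close>

lemma Good_consistency_iff:
  assumes L: "language_ok (Lang \<xi>)" and "states_consistency \<xi> k \<alpha> \<Psi>"
  shows "Good (Lang \<xi>) (ereal N) \<Psi> \<longleftrightarrow>
    (\<forall>x y p q. real x < 2 powr N \<and> real y < 2 powr N \<and> real p < 2 powr N \<and> real q < 2 powr N
       \<longrightarrow> \<not> conflict \<xi> k \<alpha> x y p q)"
proof -
  let ?L = "Lang \<xi>"
  obtain \<nu> \<pi> where \<nu>: "\<And>e. sat (Std ?L) \<nu> e \<longleftrightarrow> Neg_rel \<xi> k (e 0) (e 1)"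
    and \<pi>: "\<And>e. sat (Std ?L) \<pi> e \<longleftrightarrow> Prf_rel \<xi> \<alpha> (e 0) (e 1)"
    and \<Psi>: "\<Psi> = All (All (All (All (Neg
              (Conj (inst \<nu> [Var 3, Var 2])
                 (Conj (inst \<pi> [Var 3, Var 1]) (inst \<pi> [Var 2, Var 0])))))))"
    using assms(2) unfolding states_consistency_def by metis
  show ?thesis
    unfolding \<Psi> Good.simps true_std_def sat_Scope_All[OF L]
    by (simp add: inst_def sat_subst \<nu> \<pi> conflict_def numeral_eq_Suc) blast
qed

section \<open>Stability excludes inconsistency\<close>

lemma no_conflict:
  assumes \<xi>: "generic_config \<xi>" and EA: "EA_stable \<xi>"
    and S: "Pi_sentence \<xi> 1 S" "states_consistency \<xi> 1 (Base \<xi> \<union> {S}) S"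
  shows "\<not> conflict \<xi> 1 (Base \<xi> \<union> {S}) x y p q"
proof
  assume conf: "conflict \<xi> 1 (Base \<xi> \<union> {S}) x y p q"
  let ?L = "Lang \<xi>" and ?\<alpha> = "Base \<xi> \<union> {S}"
  have L: "language_ok ?L" and D: "Delta0_ok \<xi>" and enc: "encoding_ok \<xi>"
    using \<xi> by (auto simp: generic_config_def)
  note good = Good_consistency_iff[OF L S(2)]
  \<comment> \<open>A smaller bound leaves fewer candidate counterexamples.\<close>
  have mono: "Good ?L (ereal M) S" if "Good ?L (ereal N) S" "M \<le> N" for M N
  proof -
    have "(2::real) powr M \<le> 2 powr N" using that by simp
    then show ?thesis using that(1) unfolding good by (meson less_le_trans)
  qed
  have "\<exists>n::nat. \<not> Good ?L (ereal n) S"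
  proof -
    \<comment> \<open>Since \<open>n < 2 ^ n\<close>, the maximum itself serves as an exponent that
      bounds all four components.\<close>
    define n where "n = max (max x y) (max p q)"
    have lt: "real m < 2 powr real n" if "m \<le> n" for m
    proof -
      have "real m \<le> real n" using that by simp
      also have "\<dots> < 2 ^ n" by (rule of_nat_less_two_power)
      finally show ?thesis by (simp add: powr_realpow)
    qed
    have "x \<le> n" "y \<le> n" "p \<le> n" "q \<le> n" by (simp_all add: n_def)
    then have "\<not> Good ?L (ereal (real n)) S"
      using conf lt[of x] lt[of y] lt[of p] lt[of q] unfolding good by blast
    then show ?thesis ..
  qed
  then obtain n :: nat where n: "\<not> Good ?L (ereal n) S" "\<forall>m<n. Good ?L (ereal m) S"
    using exists_least_iff[of "\<lambda>n. \<not> Good ?L (ereal (real n)) S"] by (meson not_not)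
  \<comment> \<open>At level 0 every component would be below 1, hence 0, but codes of proofs are
    positive. So the least failing level has a predecessor \<open>m\<close>.\<close>
  have "p \<noteq> 0" if "Prf_rel \<xi> ?\<alpha> x p" for x p
    using that enc by (auto simp: Prf_rel_def proof_of_def encoding_ok_def)
  then have "Good ?L (ereal 0) S"
    unfolding good conflict_def by force
  with n(1) have "n \<noteq> 0" by (metis of_nat_0)
  then obtain m where m: "n = Suc m" by (cases n) auto
  \<comment> \<open>Minimality of \<open>n\<close> gives goodness at \<open>m\<close>, and
    monotonicity carries the failure at \<open>n\<close> to all larger integers.\<close>
  have sharp: "sharp ?L {S} = ereal (real m)"
  proof -
    have "\<not> Good ?L (ereal (of_int K)) S" if "int m < K" for K
      using n(1) mono[of "of_int K" "real n"] that unfolding m by force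
    then show ?thesis using sharp_singleton[of ?L "int m" S] n(2) m by simp
  qed
  \<comment> \<open>The counterexample given at the start may be too large. Failure at level
    \<open>n\<close> yields a fresh one whose proofs have logarithm below \<open>n\<close>, that is,
    below \<open>sharp ?L {S} + 1\<close>.\<close>
  obtain x y p q where bounds: "real p < 2 powr real n" "real q < 2 powr real n"
    and conf: "conflict \<xi> 1 ?\<alpha> x y p q"
    using n(1) unfolding good by blast
  have inj: "X = Y" if "formula ?L X" "formula ?L Y" "gnum \<xi> X = gnum \<xi> Y" for X Y
    using that enc by (auto simp: encoding_ok_def inj_on_def)
  have sentence: "formula ?L X" if "sentence ?L X" for X
    using that by (auto simp: sentence_def formula_def)
  obtain \<phi> where \<phi>: "Pi_sentence \<xi> 1 \<phi>" "gnum \<xi> \<phi> = x" "gnum \<xi> (prenex_neg \<phi>) = y"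
    using conf by (auto simp: conflict_def Neg_rel_def)
  note neg = Sigma_sentence_prenex_neg[OF D \<phi>(1)]
  obtain X Y where X: "sentence ?L X" "gnum \<xi> X = x" "proof_of \<xi> ?\<alpha> p X"
    and Y: "sentence ?L Y" "gnum \<xi> Y = y" "proof_of \<xi> ?\<alpha> q Y"
    using conf unfolding conflict_def Prf_rel_def by blast
  \<comment> \<open>Equal codes identify the sentences actually proved with \<phi> and its prenex
    negation.\<close>
  have "X = \<phi>" using X \<phi> by (intro inj sentence) (simp_all add: Pi_sentence_def)
  then have p: "proof_of \<xi> ({S} \<union> Base \<xi>) p \<phi>" using X by (simp add: Un_commute)
  have "Y = prenex_neg \<phi>" using Y \<phi> neg by (intro inj sentence) (simp_all add: Sigma_sentence_def)
  then have q: "proof_of \<xi> ({S} \<union> Base \<xi>) q (prenex_neg \<phi>)" using Y by (simp add: Un_commute)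
  have log: "Log r < real n" if "proof_of \<xi> A r X" "real r < 2 powr real n" for A r X
  proof -
    have "r > 0" using that(1) enc by (auto simp: proof_of_def encoding_ok_def)
    then show ?thesis using that(2) by (simp add: Log_def log_less_iff)
  qed
  have RE: "{S} \<in> RE_Class \<xi>"
    using S(1) rec_enumerable_singleton by (simp add: RE_Class_def)
  have short: "ereal (Log p) \<le> sharp ?L {S} + 1" "ereal (Log q) \<le> sharp ?L {S} + 1"
    using log[OF p bounds(1)] log[OF q bounds(2)] by (simp_all add: sharp m one_ereal_def)
  have "Good ?L (sharp ?L {S} / 2) \<phi>"
    using EA RE \<phi>(1) p short(1) unfolding EA_stable_def A_stable_def by blast
  then have "Good ?L (ereal (real m / 2)) \<phi>"
    by (simp add: sharp numeral_eq_ereal del: Good.simps)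
  moreover have "Good ?L (ereal (of_int \<lfloor>Log q\<rfloor> / 2 - 1)) (prenex_neg \<phi>)"
    using EA RE neg q short(2) unfolding EA_stable_def E_stable_def by blast
  \<comment> \<open>The bound on \<open>Log q\<close> is \<open>m + 1\<close> rather than
    \<open>m\<close>; the \<open>- 1\<close> in E-stability absorbs the excess.\<close>
  moreover have "of_int \<lfloor>Log q\<rfloor> / 2 - 1 \<le> real m / 2"
    using log[OF q bounds(2)] m by linarith
  ultimately show False using Good_prenex_neg_conflict[OF L D \<phi>(1)] by blast
qed

text \<open>The implication from \<open>Conj X (Neg X)\<close> to \<open>Z\<close> is valid, so the
  indirect-implication property applied to \<open>X\<close> and \<open>Neg X\<close> replaces modus
  ponens.\<close>

lemma provable_ex_falso:
  assumes "Ded_ok \<xi>" "axiom_system \<xi> \<alpha>" "sentence (Lang \<xi>) X" "sentence (Lang \<xi>) Z"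
    and "provable \<xi> \<alpha> X" "provable \<xi> \<alpha> (Neg X)"
  shows "provable \<xi> \<alpha> Z"
proof -
  let ?I = "Impl (Conj X (Neg X)) Z"
  have "sentence (Lang \<xi>) ?I" "valid (Lang \<xi>) ?I" "sentence (Lang \<xi>) (Neg X)"
    using assms(3,4) by (simp_all add: sentence_def valid_def)
  then show ?thesis using assms unfolding Ded_ok_def by blast
qed

theorem theorem5p9:
  fixes \<xi> :: "('f, 'r, 'p) config" and S :: "('f, 'r) fm"
  assumes "generic_config \<xi>"
    and "EA_stable \<xi>"
    and "is_SelfCons \<xi> 1 (Base \<xi>) S"
  shows "self_justifying_via \<xi> 1 (Base \<xi> \<union> {S}) S"
proof -
  let ?\<alpha> = "Base \<xi> \<union> {S}"
  have D: "Delta0_ok \<xi>" "Ded_ok \<xi>" using assms(1) by (auto simp: generic_config_def)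
  have S: "Pi_sentence \<xi> 1 S" using assms(3) by (auto simp: is_SelfCons_def)
  then have sent: "sentence (Lang \<xi>) S" "sentence (Lang \<xi>) (prenex_neg S)"
    by (auto simp: Pi_sentence_def sentence_def wf_prenex_neg)
  have ax: "axiom_system \<xi> ?\<alpha>"
    using assms(1) sent by (auto simp: generic_config_def Base_ok_def axiom_system_def)
  have st: "states_consistency \<xi> 1 ?\<alpha> S"
    using assms by (intro SelfCons_states_consistency)
  have "provable \<xi> ?\<alpha> S" using D(2) ax by (auto simp: Ded_ok_def)
  moreover have "consistent \<xi> ?\<alpha>"
    unfolding consistent_def
  proof
    assume "\<exists>X. sentence (Lang \<xi>) X \<and> provable \<xi> ?\<alpha> X \<and> provable \<xi> ?\<alpha> (Neg X)"
    \<comment> \<open>The contradictory pair may have any complexity and uses \<open>Neg\<close>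
      instead of \<open>prenex_neg\<close>. Explosion trades it for proofs of \<open>S\<close> and
      \<open>prenex_neg S\<close>, which form a conflict at level 1.\<close>
    then have "provable \<xi> ?\<alpha> Z" if "sentence (Lang \<xi>) Z" for Z
      using provable_ex_falso[OF D(2) ax _ that] by blast
    then obtain p q where "proof_of \<xi> ?\<alpha> p S" "proof_of \<xi> ?\<alpha> q (prenex_neg S)"
      using sent unfolding provable_def by blast
    then have "conflict \<xi> 1 ?\<alpha> (gnum \<xi> S) (gnum \<xi> (prenex_neg S)) p q"
      using S sent unfolding conflict_def Neg_rel_def Prf_rel_def by blast
    then show False using no_conflict[OF assms(1,2) S st] by blast
  qed
  ultimately show ?thesis using st by (simp add: self_justifying_via_def)
qed

end
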